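(* Let $C$ be a compact Lie group, let $W$ be a finite-dimensional real $C$-module and let $w\in W$ be such that the orbit $Cw$ spans $W$. Then $L:=\{g\in\operatorname{GL}(W)\mid gCw=Cw\}$ is compact. *)

theory Defs
  imports "HOL-Analysis.Analysis" "HOL-Algebra.Group"
begin

text \<open>A topological group: an (abstract) group whose carrier is the underlying set
of a Hausdorff topology, with continuous multiplication and inversion.\<close>
definition topological_group :: "('c, 'm) monoid_scheme \<Rightarrow> 'c topology \<Rightarrow> bool" where
  "topological_group G T \<longleftrightarrow> group G \<and> topspace T = carrier G \<and> Hausdorff_space T \<and>
     continuous_map (prod_topology T T) T (\<lambda>(g, h). g \<otimes>\<^bsub>G\<^esub> h) \<and>
     continuous_map T T (\<lambda>g. inv\<^bsub>G\<^esub> g)"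

text \<open>A continuous finite-dimensional real representation of G on W = real^'n,
given by matrices.\<close>
definition continuous_rep ::
  "('c, 'm) monoid_scheme \<Rightarrow> 'c topology \<Rightarrow> ('c \<Rightarrow> real^'n^'n) \<Rightarrow> bool" where
  "continuous_rep G T \<rho> \<longleftrightarrow>
     continuous_map T euclidean \<rho> \<and>
     \<rho> \<one>\<^bsub>G\<^esub> = mat 1 \<and>
     (\<forall>g\<in>carrier G. \<forall>h\<in>carrier G. \<rho> (g \<otimes>\<^bsub>G\<^esub> h) = \<rho> g ** \<rho> h)"

definition orbit_rep :: "('c, 'm) monoid_scheme \<Rightarrow> ('c \<Rightarrow> real^'n^'n) \<Rightarrow> real^'n \<Rightarrow> (real^'n) set" where
  "orbit_rep G \<rho> w = (\<lambda>g. \<rho> g *v w) ` carrier G"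

end

theory Submission
  imports Defs
begin

text \<open>The orbit \<open>Cw\<close> is compact, being a continuous image of \<open>C\<close>; the group structure
plays no further role. A matrix mapping a bounded set \<open>Ob\<close> into itself sends each vector of
\<open>span Ob\<close> to a vector whose norm is bounded independently of the matrix, so if \<open>Ob\<close> spans,
all columns, hence the matrices themselves, are uniformly bounded. Mapping a closed set into
itself is a closed condition, so the matrices with \<open>A Ob \<subseteq> Ob\<close> form a compact set \<open>S\<close>.
Finally \<open>L\<close> consists of the \<open>A \<in> S\<close> with an inverse in \<open>S\<close>: the projection of the compact set
of pairs \<open>(A, B) \<in> S \<times> S\<close> with \<open>A B = 1\<close>.\<close>

lemma bounded_matrix_image_of_span:
  fixes Ob :: "(real^'n) set"
  assumes "bounded Ob" "y \<in> span Ob"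
  shows "bounded ((\<lambda>A. A *v y) ` {A::real^'n^'n. (*v) A ` Ob \<subseteq> Ob})"
proof -
  obtain t r where t: "finite t" "t \<subseteq> Ob" and y: "y = (\<Sum>a\<in>t. r a *\<^sub>R a)"
    using assms(2) unfolding span_explicit by blast
  obtain M where M: "\<And>v. v \<in> Ob \<Longrightarrow> norm v \<le> M"
    using assms(1) unfolding bounded_iff by blast
  have "norm (A *v y) \<le> (\<Sum>a\<in>t. \<bar>r a\<bar> * M)" if AO: "(*v) A ` Ob \<subseteq> Ob" for A :: "real^'n^'n"
  proof -
    have "A *v y = (\<Sum>a\<in>t. r a *\<^sub>R (A *v a))"
      by (simp add: y linear_sum[OF matrix_vector_mul_linear] matrix_vector_mult_scaleR)
    also have "norm \<dots> \<le> (\<Sum>a\<in>t. norm (r a *\<^sub>R (A *v a)))"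
      by (rule norm_sum)
    also have "\<dots> \<le> (\<Sum>a\<in>t. \<bar>r a\<bar> * M)"
    proof (rule sum_mono)
      fix a assume "a \<in> t"
      then have "A *v a \<in> Ob" using t AO by blast
      then show "norm (r a *\<^sub>R (A *v a)) \<le> \<bar>r a\<bar> * M"
        using M by (simp add: mult_left_mono)
    qed
    finally show ?thesis .
  qed
  then show ?thesis
    unfolding bounded_iff by blast
qed

lemma bounded_matrices_of_bounded_columns:
  fixes S :: "(real^'n^'m) set"
  assumes "\<And>j. bounded ((\<lambda>A. A *v axis j 1) ` S)"
  shows "bounded S"
proof -
  have "\<forall>j. \<exists>K. \<forall>A\<in>S. norm (A *v axis j 1) \<le> K"
    using assms by (simp add: bounded_iff)
  then obtain K where K: "\<And>j A. A \<in> S \<Longrightarrow> norm (A *v axis j 1) \<le> K j"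
    by metis
  have "norm A \<le> (\<Sum>i::'m\<in>UNIV. \<Sum>j\<in>UNIV. K j)" if "A \<in> S" for A
  proof -
    have "norm A \<le> (\<Sum>i\<in>UNIV. norm (A$i))"
      by (simp add: norm_vec_def L2_set_le_sum)
    also have "\<dots> \<le> (\<Sum>i\<in>UNIV. \<Sum>j\<in>UNIV. \<bar>A$i$j\<bar>)"
      by (intro sum_mono norm_le_l1_cart)
    also have "\<dots> \<le> (\<Sum>i::'m\<in>UNIV. \<Sum>j\<in>UNIV. K j)"
    proof (intro sum_mono)
      fix i j
      have "\<bar>A$i$j\<bar> \<le> norm (A *v axis j 1)"
        using component_le_norm_cart[of "A *v axis j 1" i]
        by (simp add: matrix_vector_mult_basis column_def)
      then show "\<bar>A$i$j\<bar> \<le> K j"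
        using K[OF that, of j] by linarith
    qed
    finally show ?thesis .
  qed
  then show ?thesis
    unfolding bounded_iff by blast
qed

lemma bounded_matrix_stabilizer:
  fixes Ob :: "(real^'n) set"
  assumes "bounded Ob" "span Ob = UNIV"
  shows "bounded {A::real^'n^'n. (*v) A ` Ob \<subseteq> Ob}"
  using assms by (intro bounded_matrices_of_bounded_columns bounded_matrix_image_of_span) auto

lemma closed_matrix_stabilizer:
  fixes Ob :: "(real^'n) set"
  assumes "closed Ob"
  shows "closed {A::real^'n^'n. (*v) A ` Ob \<subseteq> Ob}"
proof -
  have "closed {A::real^'n^'n. A *v x \<in> Ob}" for x
  proof -
    have "continuous_on UNIV (\<lambda>A::real^'n^'n. A *v x)"
      unfolding matrix_vector_mult_def by (intro continuous_intros)
    then show ?thesis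
      using closed_vimage[OF assms] by (simp add: vimage_def)
  qed
  moreover have "{A::real^'n^'n. (*v) A ` Ob \<subseteq> Ob} = (\<Inter>x\<in>Ob. {A. A *v x \<in> Ob})"
    by auto
  ultimately show ?thesis
    by auto
qed

lemma compact_matrix_stabilizer:
  fixes Ob :: "(real^'n) set"
  assumes "compact Ob" "span Ob = UNIV"
  shows "compact {A::real^'n^'n. (*v) A ` Ob \<subseteq> Ob}"
  using assms by (simp add: compact_eq_bounded_closed bounded_matrix_stabilizer
      closed_matrix_stabilizer)

lemma compact_right_invertible_within:
  fixes S :: "(real^'n^'n) set"
  assumes "compact S"
  shows "compact {A \<in> S. \<exists>B\<in>S. A ** B = mat 1}"
proof -
  have "closed {p::(real^'n^'n) \<times> (real^'n^'n). fst p ** snd p = mat 1}"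
    by (intro closed_Collect_eq) (auto simp: matrix_matrix_mult_def intro!: continuous_intros)
  then have "compact ((S \<times> S) \<inter> {p. fst p ** snd p = mat 1})"
    using assms by (intro compact_Int_closed compact_Times)
  then have "compact (fst ` ((S \<times> S) \<inter> {p. fst p ** snd p = mat 1}))"
    by (intro compact_continuous_image continuous_intros)
  moreover have "fst ` ((S \<times> S) \<inter> {p. fst p ** snd p = mat 1}) = {A \<in> S. \<exists>B\<in>S. A ** B = mat 1}"
    by force
  ultimately show ?thesis
    by simp
qed

lemma invertible_permuting_iff:
  fixes A :: "real^'n^'n" and Ob :: "(real^'n) set"
  shows "invertible A \<and> (*v) A ` Ob = Ob \<longleftrightarrow>
    (*v) A ` Ob \<subseteq> Ob \<and> (\<exists>B. (*v) B ` Ob \<subseteq> Ob \<and> A ** B = mat 1)"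
proof
  assume "invertible A \<and> (*v) A ` Ob = Ob"
  then obtain B where AB: "A ** B = mat 1" and BA: "B ** A = mat 1" and AO: "(*v) A ` Ob = Ob"
    unfolding invertible_def by blast
  have "B *v (A *v z) = z" for z
    using BA by (simp add: matrix_vector_mul_assoc)
  then have "(*v) B ` Ob \<subseteq> Ob"
    using AO by (metis image_subset_iff imageE)
  then show "(*v) A ` Ob \<subseteq> Ob \<and> (\<exists>B. (*v) B ` Ob \<subseteq> Ob \<and> A ** B = mat 1)"
    using AO AB by blast
next
  assume "(*v) A ` Ob \<subseteq> Ob \<and> (\<exists>B. (*v) B ` Ob \<subseteq> Ob \<and> A ** B = mat 1)"
  then obtain B where AO: "(*v) A ` Ob \<subseteq> Ob" and BO: "(*v) B ` Ob \<subseteq> Ob"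
    and AB: "A ** B = mat 1" by blast
  have "invertible A"
    using AB matrix_left_right_inverse unfolding invertible_def by blast
  moreover have "v = A *v (B *v v)" for v
    using AB by (simp add: matrix_vector_mul_assoc)
  then have "Ob \<subseteq> (*v) A ` Ob"
    using BO by blast
  ultimately show "invertible A \<and> (*v) A ` Ob = Ob"
    using AO by blast
qed

lemma compact_orbit_rep:
  assumes "topological_group G T" "compact_space T" "continuous_rep G T \<rho>"
  shows "compact (orbit_rep G \<rho> w)"
proof -
  have "compactin euclidean (\<rho> ` topspace T)"
    using assms(2,3) image_compactin[of T "topspace T" euclidean \<rho>]
    by (simp add: compact_space_def continuous_rep_def)
  then have "compact ((\<lambda>A. A *v w) ` \<rho> ` topspace T)"
    by (intro compact_continuous_image) (auto simp: matrix_vector_mult_def continuous_intros)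
  moreover have "topspace T = carrier G"
    using assms(1) by (simp add: topological_group_def)
  ultimately show ?thesis
    by (simp add: orbit_rep_def image_image)
qed

theorem proposition2p2:
  fixes G :: "('c, 'm) monoid_scheme" and T :: "'c topology"
    and \<rho> :: "'c \<Rightarrow> real^'n^'n" and w :: "real^'n"
  assumes "topological_group G T"
    and "compact_space T"
    and "continuous_rep G T \<rho>"
    and "span (orbit_rep G \<rho> w) = UNIV"
  shows "compact {A :: real^'n^'n. invertible A \<and> (\<lambda>x. A *v x) ` orbit_rep G \<rho> w = orbit_rep G \<rho> w}"
proof -
  define Ob where "Ob = orbit_rep G \<rho> w"
  define S where "S = {A::real^'n^'n. (*v) A ` Ob \<subseteq> Ob}"
  have "compact S"
    unfolding S_def Ob_def using assms by (intro compact_matrix_stabilizer compact_orbit_rep)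
  then have "compact {A \<in> S. \<exists>B\<in>S. A ** B = mat 1}"
    by (rule compact_right_invertible_within)
  moreover have "{A \<in> S. \<exists>B\<in>S. A ** B = mat 1} = {A. invertible A \<and> (*v) A ` Ob = Ob}"
    unfolding S_def by (auto simp: invertible_permuting_iff)
  ultimately show ?thesis
    by (simp add: Ob_def)
qed

end
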